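(* Let $k$ be a positive odd integer. Then there exists a tournament $T$ with $\det(T)=k^2$.
   Context: A tournament is a directed graph with exactly one arc between each pair of distinct vertices. For a tournament $T$ on vertices $v_1,\dots,v_n$, its skew-adjacency matrix is the $n\times n$ zero-diagonal matrix $S_T=[s_{ij}]$ with $s_{ij}=-s_{ji}=1$ if there is an arc from $v_i$ to $v_j$, and $\det(T):=\det(S_T)$. *)

theory Defs
  imports "Graph_Theory.Pair_Digraph" "Jordan_Normal_Form.Determinant"
begin

definition tournament :: "'a pair_pre_digraph \<Rightarrow> bool" where
  "tournament T \<longleftrightarrow> pair_digraph T \<and> pverts T \<noteq> {} \<and>
     (\<forall>u\<in>pverts T. \<forall>v\<in>pverts T. u \<noteq> v \<longrightarrow> ((u, v) \<in> parcs T) \<noteq> ((v, u) \<in> parcs T))"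

text \<open>The list \<open>vs\<close> enumerates the vertices.\<close>

definition skew_adj_mat :: "'a pair_pre_digraph \<Rightarrow> 'a list \<Rightarrow> int mat" where
  "skew_adj_mat T vs = mat (length vs) (length vs) (\<lambda>(i, j).
     if i = j then 0
     else if (vs ! i, vs ! j) \<in> parcs T then 1
     else if (vs ! j, vs ! i) \<in> parcs T then - 1
     else 0)"

text \<open>The enumeration is chosen arbitrarily; by \<open>tournament_det_eq\<close> below the value does
  not depend on the choice.\<close>

definition tournament_det :: "'a pair_pre_digraph \<Rightarrow> int" where
  "tournament_det T = det (skew_adj_mat T (SOME vs. distinct vs \<and> set vs = pverts T))"

lemma det_permute_rows_cols:
  fixes A :: "'a :: comm_ring_1 mat"
  assumes A: "A \<in> carrier_mat n n" and p: "p permutes {0..<n}"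
  shows "det (mat n n (\<lambda>(i, j). A $$ (p i, p j))) = det A"
proof -
  let ?B = "mat n n (\<lambda>(i, j). A $$ (p i, j))"
  let ?C = "transpose_mat ?B"
  have C: "?C \<in> carrier_mat n n" by simp
  have pn: "p i < n" if "i < n" for i
    using permutes_in_image[OF p, of i] that by simp
  have "mat n n (\<lambda>(i, j). A $$ (p i, p j)) = transpose_mat (mat n n (\<lambda>(i, j). ?C $$ (p i, j)))"
    by (rule eq_matI) (auto simp: pn)
  hence "det (mat n n (\<lambda>(i, j). A $$ (p i, p j))) = det (mat n n (\<lambda>(i, j). ?C $$ (p i, j)))"
    by (simp add: det_transpose[of _ n])
  also have "\<dots> = signof p * det ?C"
    by (rule det_permute_rows[OF C p])
  also have "det ?C = signof p * det A"
    using det_permute_rows[OF A p] det_transpose[of ?B n] by simp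
  finally show ?thesis
    by (simp add: sign_def)
qed

lemma det_skew_adj_mat_unique:
  assumes "distinct vs" "distinct ws" "set vs = set ws"
  shows "det (skew_adj_mat T vs) = det (skew_adj_mat T ws)"
proof -
  have "mset vs = mset ws"
    using assms set_eq_iff_mset_eq_distinct by blast
  then obtain p where p: "p permutes {..<length ws}" and vs: "permute_list p ws = vs"
    using mset_eq_permutation by metis
  let ?n = "length ws"
  have len: "length vs = ?n"
    using vs by auto
  have p': "p permutes {0..<?n}"
    using p by (simp add: atLeast0LessThan)
  have pn: "p i < ?n" if "i < ?n" for i
    using permutes_in_image[OF p, of i] that by simp
  have nth: "vs ! i = ws ! p i" if "i < ?n" for i
    using permute_list_nth[OF p that] vs by simp
  have inj: "p i = p j \<longleftrightarrow> i = j" for i j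
    using permutes_inj[OF p] by (auto dest: injD)
  have "skew_adj_mat T vs = mat ?n ?n (\<lambda>(i, j). skew_adj_mat T ws $$ (p i, p j))"
    by (rule eq_matI) (auto simp: skew_adj_mat_def len nth pn inj)
  thus ?thesis
    using det_permute_rows_cols[OF _ p', of "skew_adj_mat T ws"]
    by (simp add: skew_adj_mat_def)
qed

lemma tournament_det_eq:
  assumes "distinct vs" "set vs = pverts T"
  shows "tournament_det T = det (skew_adj_mat T vs)"
proof -
  have "distinct (SOME vs. distinct vs \<and> set vs = pverts T) \<and>
        set (SOME vs. distinct vs \<and> set vs = pverts T) = pverts T"
    by (rule someI[of _ vs]) (use assms in simp)
  thus ?thesis
    unfolding tournament_det_def using assms by (intro det_skew_adj_mat_unique) auto
qed

end

theory Submission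
  imports Defs
begin

text \<open>Take the transitive tournament on \<open>{0..<k}\<close> and add a vertex \<open>k\<close> that is dominated by the
  even and dominates the odd vertices. The skew-adjacency matrix of the transitive part has the
  kernel vector \<open>w = (1, -1, 1, \<dots>, 1)\<close>, which is also the last column of the bordered matrix;
  eliminating with \<open>w\<close> therefore splits off the factor \<open>w\<^sup>T w = k\<close>. After passing to differences
  of consecutive rows the remaining minor is triangular up to one column, and clearing
  that column leaves the second factor \<open>k\<close>.\<close>

definition alternating_tournament :: "nat \<Rightarrow> nat pair_pre_digraph" where
  "alternating_tournament k = \<lparr>pverts = {..k},
     parcs = {(i, j). i < j \<and> j < k} \<union> {(i, k) |i. i < k \<and> even i} \<union> {(k, i) |i. i < k \<and> odd i}\<rparr>"

lemma tournament_alternating_tournament: "tournament (alternating_tournament k)"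
proof -
  have "parcs (alternating_tournament k) \<subseteq> {..k} \<times> {..k}"
    by (auto simp: alternating_tournament_def)
  hence "finite (parcs (alternating_tournament k))"
    by (rule finite_subset) simp
  thus ?thesis
    unfolding tournament_def
    by (auto simp: alternating_tournament_def intro!: pair_digraph.intro
        pair_fin_digraph.intro pair_wf_digraph.intro pair_fin_digraph_axioms.intro
        pair_loopfree_digraph.intro pair_loopfree_digraph_axioms.intro)
qed

text \<open>Parity is encoded as the sign \<open>(- 1) ^ i\<close>, so that the border column is
  literally the kernel vector. The test \<open>i = j\<close> comes first, which makes the corner
  \<open>(k, k)\<close> zero.\<close>

definition alternating_entry :: "nat \<Rightarrow> nat \<Rightarrow> nat \<Rightarrow> int" where
  "alternating_entry k i j =
     (if i = j then 0
      else if j = k then (- 1) ^ i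
      else if i = k then - ((- 1) ^ j)
      else if i < j then 1 else - 1)"

lemma skew_adj_mat_alternating_tournament:
  "skew_adj_mat (alternating_tournament k) [0..<k + 1] =
     mat (k + 1) (k + 1) (\<lambda>(i, j). alternating_entry k i j)"
  by (rule eq_matI)
    (auto simp: skew_adj_mat_def alternating_tournament_def alternating_entry_def
      simp del: upt_Suc)

lemma sum_alternating_even: "(\<Sum>j<2 * m. (- 1) ^ j) = (0 :: int)"
  by (induction m) auto

text \<open>Each pair of indices \<open>2 * t\<close>, \<open>2 * t + 1\<close> contributes
  \<open>- 1\<close>.\<close>

lemma sum_alternating_linear_even: "(\<Sum>j<2 * m. (- 1) ^ j * int j) = - int m"
  by (induction m) auto

text \<open>The row operations amount to left multiplication by a unit upper bidiagonal matrix,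
  which has determinant 1.\<close>

lemma det_diff_rows:
  fixes a :: "nat \<Rightarrow> nat \<Rightarrow> 'a :: comm_ring_1"
  assumes "k \<le> n"
  shows "det (mat n n (\<lambda>(i, j). if Suc i < k then a i j - a (Suc i) j else a i j)) =
    det (mat n n (\<lambda>(i, j). a i j))"
proof -
  let ?D = "mat n n (\<lambda>(i, j). of_bool (j = i) - of_bool (j = Suc i \<and> Suc i < k)) :: 'a mat"
  let ?A = "mat n n (\<lambda>(i, j). a i j)"
  have "det ?D = prod_list (diag_mat ?D)"
    by (rule det_upper_triangular[of _ n]) (auto simp: upper_triangular_def)
  also have "\<dots> = 1"
    by (auto simp: prod_list_diag_prod)
  finally have D: "det ?D = 1" .
  have "mat n n (\<lambda>(i, j). if Suc i < k then a i j - a (Suc i) j else a i j) = ?D * ?A"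
  proof (rule eq_matI)
    fix i j assume "i < dim_row (?D * ?A)" "j < dim_col (?D * ?A)"
    hence "i < n" "j < n" by simp_all
    have "(\<Sum>l = 0..<n. (of_bool (l = i) - of_bool (l = Suc i \<and> Suc i < k)) * a l j) =
      (\<Sum>l = 0..<n. (if l = i then a l j else 0) -
         (if l = Suc i then if Suc i < k then a l j else 0 else 0))"
      by (rule sum.cong) auto
    also have "\<dots> = (if Suc i < k then a i j - a (Suc i) j else a i j)"
      using \<open>i < n\<close> assms unfolding sum_subtractf by auto
    finally show "mat n n (\<lambda>(i, j). if Suc i < k then a i j - a (Suc i) j else a i j) $$ (i, j) =
      (?D * ?A) $$ (i, j)"
      using \<open>i < n\<close> \<open>j < n\<close> by (auto simp: scalar_prod_def)
  qed simp_all
  thus ?thesis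
    by (simp add: det_mult[of _ n] D)
qed

text \<open>Cramer's rule: putting \<open>A x\<close> into column \<open>c\<close> of
  \<open>A\<close> multiplies the determinant by \<open>x c\<close>.\<close>

lemma det_replace_col_combination:
  fixes a :: "nat \<Rightarrow> nat \<Rightarrow> 'a :: comm_ring_1"
  assumes "c < n" "x c = 1"
  shows "det (mat n n (\<lambda>(i, j). if j = c then \<Sum>l<n. a i l * x l else a i j)) =
    det (mat n n (\<lambda>(i, j). a i j))"
proof -
  let ?A = "mat n n (\<lambda>(i, j). a i j)"
  have "mat n n (\<lambda>(i, j). if j = c then \<Sum>l<n. a i l * x l else a i j) =
    replace_col ?A (?A *\<^sub>v vec n x) c"
    by (rule eq_matI) (auto simp: replace_col_def scalar_prod_def atLeast0LessThan)
  thus ?thesis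
    using cramer_lemma_mat[of ?A n "vec n x" c] assms by simp
qed

lemma det_alternating_entry:
  assumes k: "k = 2 * m + 1"
  shows "det (mat (k + 1) (k + 1) (\<lambda>(i, j). alternating_entry k i j)) = (int k)\<^sup>2"
proof -
  let ?n = "k + 1"
  define r where "r i j = (if Suc i < k then alternating_entry k i j - alternating_entry k (Suc i) j
    else alternating_entry k i j)" for i j
  \<comment> \<open>Extending the kernel vector by 0 keeps the border column out of the
    combination.\<close>
  define w where "w j = (if j < k then (- 1) ^ j else 0 :: int)" for j
  define b where "b i j = (if j = 0 then \<Sum>l<?n. r i l * w l else r i j)" for i j
  \<comment> \<open>Clearing column \<open>k\<close> above row \<open>2 * m\<close> requires
    \<open>x i + x (Suc i) = - 2 * (- 1) ^ i\<close>. The solution with \<open>x 0 = 0\<close> is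
    taken because column 0 has already been altered.\<close>
  define x where "x j = (if j < k then 2 * ((- 1) ^ j * int j) else 1)" for j
  define c where "c i j = (if j = k then \<Sum>l<?n. b i l * x l else b i j)" for i j

  have r_upper: "r i j = (if j = k then 2 * (- 1) ^ i else of_bool (j = i) + of_bool (j = Suc i))"
    if "Suc i < k" "j \<le> k" for i j
    using that by (auto simp: r_def alternating_entry_def)
  have r_last: "r (2 * m) j = (if j = k then 1 else if j = 2 * m then 0 else - 1)" if "j \<le> k" for j
    using that by (auto simp: r_def alternating_entry_def k)
  have r_border: "r k j = (if j = k then 0 else - ((- 1) ^ j))" if "j \<le> k" for j
    using that by (auto simp: r_def alternating_entry_def)

  have b_upper: "b i 0 = 0" if "Suc i < k" for i
  proof -
    have "b i 0 = (\<Sum>l<k. r i l * (- 1) ^ l)"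
      by (simp add: b_def w_def)
    also have "\<dots> = (\<Sum>l<k. (if l = i then (- 1) ^ l else 0) + (if l = Suc i then (- 1) ^ l else 0))"
      using that by (intro sum.cong) (auto simp: r_upper)
    also have "\<dots> = 0"
      using that unfolding sum.distrib by simp
    finally show ?thesis .
  qed
  have b_last: "b (2 * m) 0 = 0"
  proof -
    have "b (2 * m) 0 = (\<Sum>l<2 * m. r (2 * m) l * (- 1) ^ l)"
      \<comment> \<open>The diagonal term \<open>l = 2 * m\<close> vanishes, leaving an even number
        of alternating terms.\<close>
      using r_last[of "2 * m"] by (simp add: b_def w_def k)
    also have "\<dots> = (\<Sum>l<2 * m. - ((- 1) ^ l))"
      by (rule sum.cong) (auto simp: r_last k)
    finally show ?thesis
      by (simp add: sum_negf sum_alternating_even)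
  qed
  have b_border: "b k 0 = - int k"
  proof -
    have "b k 0 = (\<Sum>l<k. r k l * (- 1) ^ l)"
      by (simp add: b_def w_def)
    \<comment> \<open>Border row and \<open>w\<close> agree up to sign, so this is minus the squared
      norm of \<open>w\<close>.\<close>
    also have "\<dots> = (\<Sum>l<k. - 1)"
      by (rule sum.cong) (auto simp: r_border simp flip: power_add mult_2)
    finally show ?thesis by simp
  qed

  have c_upper: "c i k = 0" if "Suc i < k" for i
  proof -
    have "c i k = (\<Sum>l<k. b i l * (2 * ((- 1) ^ l * int l))) + 2 * (- 1) ^ i"
      using that by (simp add: c_def x_def b_def r_upper)
    also have "(\<Sum>l<k. b i l * (2 * ((- 1) ^ l * int l))) =
      (\<Sum>l<k. (if l = i then 2 * ((- 1) ^ l * int l) else 0) +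
        (if l = Suc i then 2 * ((- 1) ^ l * int l) else 0))"
      using that by (intro sum.cong) (auto simp: b_def r_upper)
    also have "\<dots> = - 2 * (- 1) ^ i"
      using that unfolding sum.distrib by (simp add: algebra_simps)
    finally show ?thesis by simp
  qed
  have c_last: "c (2 * m) k = int k"
  proof -
    have "c (2 * m) k = (\<Sum>l<2 * m. b (2 * m) l * (2 * ((- 1) ^ l * int l))) + 1"
      using r_last[of "2 * m"] r_last[of k] by (simp add: c_def x_def b_def k)
    also have "(\<Sum>l<2 * m. b (2 * m) l * (2 * ((- 1) ^ l * int l))) =
      (\<Sum>l<2 * m. - 2 * ((- 1) ^ l * int l))"
    proof (rule sum.cong)
      fix l assume l: "l \<in> {..<2 * m}"
      \<comment> \<open>In column 0 the entry \<open>- 1\<close> of \<open>r\<close> has been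
        replaced, but there the factor \<open>int l\<close> is zero.\<close>
      have "l = 0 \<or> b (2 * m) l = - 1"
        using l k r_last[of l] by (simp add: b_def)
      thus "b (2 * m) l * (2 * ((- 1) ^ l * int l)) = - 2 * ((- 1) ^ l * int l)"
      proof
        assume "b (2 * m) l = - 1"
        thus ?thesis by (simp only: mult_minus1 mult_minus_left)
      qed simp
    qed simp
    also have "\<dots> = 2 * int m"
      unfolding sum_distrib_left[symmetric] sum_alternating_linear_even by simp
    finally show ?thesis by (simp add: k)
  qed

  let ?C = "mat ?n ?n (\<lambda>(i, j). c i j)"
  let ?M = "mat_delete ?C k 0"
  have "k > 0" by (simp add: k)
  have C0: "c i 0 = (if i = k then - int k else 0)" if i: "i < ?n" for i
  proof -
    consider "Suc i < k" | "i = 2 * m" "i \<noteq> k" | "i = k" using i k by linarith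
    thus ?thesis
      using \<open>k > 0\<close> i by cases (simp_all add: c_def b_upper b_last b_border)
  qed
  \<comment> \<open>Deleting column 0 shifts the superdiagonal of \<open>c\<close> onto the
    diagonal: ones from the row differences, then \<open>k\<close> from the cleared column.\<close>
  have M_eq: "?M = mat k k (\<lambda>(i, j). c i (Suc j))"
    by (rule eq_matI) (auto simp: mat_delete_def)
  have M: "c i (Suc j) = 0" if "i < j" "j < k" for i j
    using that by (cases "Suc j = k") (auto simp: c_upper, simp add: c_def b_def r_upper)
  have diag: "c i (Suc i) = (if i = 2 * m then int k else 1)" if "i < k" for i
  proof (cases "i = 2 * m")
    case True
    thus ?thesis using c_last by (simp add: k)
  next
    case False
    hence "Suc i < k" using that k by linarith
    thus ?thesis using False by (simp add: c_def b_def r_upper)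
  qed
  have "det ?M = prod_list (diag_mat ?M)"
    unfolding M_eq by (rule det_lower_triangular[of k]) (auto simp: M)
  also have "\<dots> = (\<Prod>i = 0..<k. if i = 2 * m then int k else 1)"
    unfolding M_eq prod_list_diag_prod by (auto intro!: prod.cong simp: diag)
  also have "\<dots> = int k"
    by (simp add: k)
  finally have detM: "det ?M = int k" .

  have "det (mat ?n ?n (\<lambda>(i, j). alternating_entry k i j)) = det (mat ?n ?n (\<lambda>(i, j). r i j))"
    unfolding r_def by (subst det_diff_rows) auto
  also have "\<dots> = det (mat ?n ?n (\<lambda>(i, j). b i j))"
    unfolding b_def using \<open>k > 0\<close> by (subst det_replace_col_combination) (auto simp: w_def)
  also have "\<dots> = det ?C"
    unfolding c_def by (subst det_replace_col_combination) (auto simp: x_def)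
  also have "\<dots> = (\<Sum>i<?n. ?C $$ (i, 0) * cofactor ?C i 0)"
    by (rule laplace_expansion_column) auto
  also have "\<dots> = (\<Sum>i<?n. if i = k then - int k * cofactor ?C i 0 else 0)"
    by (intro sum.cong) (auto simp: C0)
  also have "\<dots> = - int k * cofactor ?C k 0"
    by simp
  \<comment> \<open>As \<open>k\<close> is odd, the cofactor sign at position \<open>(k, 0)\<close>
    is \<open>- 1\<close> and cancels the sign of the entry \<open>- int k\<close>.\<close>
  also have "\<dots> = (int k)\<^sup>2"
    unfolding cofactor_def detM by (simp add: k power2_eq_square algebra_simps)
  finally show ?thesis .
qed

theorem theorem4p4:
  fixes k :: int
  assumes "k > 0" and "odd k"
  shows "\<exists>T :: nat pair_pre_digraph. tournament T \<and> tournament_det T = k\<^sup>2"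
proof -
  have "odd (nat k)"
    using assms by (simp add: even_nat_iff)
  then obtain m where m: "nat k = 2 * m + 1"
    by (elim oddE)
  let ?T = "alternating_tournament (nat k)"
  have "tournament_det ?T = det (skew_adj_mat ?T [0..<nat k + 1])"
    by (rule tournament_det_eq) (auto simp: alternating_tournament_def)
  also have "\<dots> = k\<^sup>2"
    using assms unfolding skew_adj_mat_alternating_tournament det_alternating_entry[OF m] by simp
  finally show ?thesis
    using tournament_alternating_tournament by blast
qed

end
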